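(* For any strictly Bayes blunting twist $\eta_c\mapsto\eta_t$ (with $\eta_c,\eta_t:\mathcal X\to[0,1]$ the clean and twisted posterior mappings), there exist a fixed $\alpha_0>1$ and an optimal $\alpha^\star$-mapping, $\alpha^\star:\mathcal X\to\mathbb R_{>1}$, which induces the following ordering: $$D_{\mathrm{KL}}(\eta_t,\eta_c;1)\;>\;D_{\mathrm{KL}}(\eta_t,\eta_c;\alpha_0)\;\ge\;D_{\mathrm{KL}}(\eta_t,\eta_c;\alpha^\star).$$
   Context: $\mathcal X$ is a domain of observations with a marginal probability distribution $\mathsf M$. The mappings $\eta_c,\eta_t:\mathcal X\to[0,1]$ give the clean and the twisted posterior probabilities that the label $Y\in\{-1,1\}$ equals $1$ given $X=x$; a twist is a mapping $\eta_c\mapsto\eta_t$. A twist is strictly Bayes blunting iff (at each $x$) $(\eta_c<\eta_t\le 1/2)\vee(\eta_c>\eta_t\ge1/2)$. For real $\alpha>0$ the Bayes tilted estimate of the $\alpha$-loss is $t_{\ell^\alpha}(v)=\frac{v^\alpha}{v^\alpha+(1-v)^\alpha}$, $v\in[0,1]$. (It is the minimizer over $u\in[0,1]$ of $v\,\ell_1^\alpha(u)+(1-v)\,\ell_1^\alpha(1-u)$, where $\ell_1^\alpha(u)=\frac{\alpha}{\alpha-1}(1-u^{(\alpha-1)/\alpha})$ and $\ell_1^1(u)=-\log u$.) For $\alpha$ a constant or a mapping on $\mathcal X$ (in which case $\alpha(X)$ is used at $X$), define $$\mathrm{CE}(\eta_t,\eta_c;\alpha)=\mathbb E_{X\sim\mathsf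 M}\big[-\eta_c(X)\log t_{\ell^\alpha}(\eta_t(X))-(1-\eta_c(X))\log t_{\ell^\alpha}(1-\eta_t(X))\big],$$ $H(\eta_c)=\mathbb E_{X\sim\mathsf M}[H_b(\eta_c(X))]$ with $H_b(u)=-u\log u-(1-u)\log(1-u)$, and $$D_{\mathrm{KL}}(\eta_t,\eta_c;\alpha)=\mathrm{CE}(\eta_t,\eta_c;\alpha)-H(\eta_c).$$ This quantity evaluates how well the Bayes tilted estimate with hyperparameter $\alpha$ untwists the twisted posterior mapping into the clean one (smaller is better). An optimal $\alpha^\star$-mapping is one that optimally untwists the strictly Bayes blunting twist in this sense.
   Formalization: Two hypotheses are added, as the claim fails otherwise: η_t is not almost everywhere 1/2 (else D_KL is constant in α), and almost everywhere η_c ∈ {0,1} only where η_t = 1/2 (else no real-valued optimal α* exists). The posteriors are taken to be measurable. *)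

theory Defs
  imports "HOL-Probability.Probability"
begin

definition posterior :: "'a measure \<Rightarrow> ('a \<Rightarrow> real) \<Rightarrow> bool" where
  "posterior M \<eta> \<longleftrightarrow> \<eta> \<in> borel_measurable M \<and> (\<forall>x\<in>space M. 0 \<le> \<eta> x \<and> \<eta> x \<le> 1)"

text \<open>A twist of posteriors is given by the pair consisting of the clean and the twisted posterior.\<close>

definition strictly_Bayes_blunting :: "'a measure \<Rightarrow> ('a \<Rightarrow> real) \<Rightarrow> ('a \<Rightarrow> real) \<Rightarrow> bool" where
  "strictly_Bayes_blunting M \<eta>\<^sub>c \<eta>\<^sub>t \<longleftrightarrow>
     (\<forall>x\<in>space M. (\<eta>\<^sub>c x < \<eta>\<^sub>t x \<and> \<eta>\<^sub>t x \<le> 1/2) \<or> (\<eta>\<^sub>c x > \<eta>\<^sub>t x \<and> \<eta>\<^sub>t x \<ge> 1/2))"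

definition tilted :: "real \<Rightarrow> real \<Rightarrow> real" where
  "tilted \<alpha> v = v powr \<alpha> / (v powr \<alpha> + (1 - v) powr \<alpha>)"

text \<open>The integrand is nonnegative, so the expectation always exists in \<open>[0, \<infinity>]\<close>; it is taken
  as a nonnegative integral because the cross-entropy of a non-constant \<open>\<alpha>\<close>-mapping can be
  infinite, where a Bochner integral would silently return \<open>0\<close>. Under a strictly Bayes blunting
  twist, \<open>0 < \<eta>\<^sub>t x < 1\<close>, so both arguments of \<open>ln\<close> are positive when \<open>\<alpha> x > 0\<close>.\<close>

definition CE :: "'a measure \<Rightarrow> ('a \<Rightarrow> real) \<Rightarrow> ('a \<Rightarrow> real) \<Rightarrow> ('a \<Rightarrow> real) \<Rightarrow> ennreal" where
  "CE M \<eta>\<^sub>t \<eta>\<^sub>c \<alpha> = (\<integral>\<^sup>+ x. ennreal (- \<eta>\<^sub>c x * ln (tilted (\<alpha> x) (\<eta>\<^sub>t x))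
                              - (1 - \<eta>\<^sub>c x) * ln (tilted (\<alpha> x) (1 - \<eta>\<^sub>t x))) \<partial>M)"

text \<open>The convention \<open>0 log 0 = 0\<close> is respected, since \<open>0 * ln 0 = 0\<close>.\<close>

definition binary_entropy :: "real \<Rightarrow> real" where
  "binary_entropy u = - u * ln u - (1 - u) * ln (1 - u)"

definition entropy_of :: "'a measure \<Rightarrow> ('a \<Rightarrow> real) \<Rightarrow> real" where
  "entropy_of M \<eta>\<^sub>c = (\<integral>x. binary_entropy (\<eta>\<^sub>c x) \<partial>M)"

definition D_KL :: "'a measure \<Rightarrow> ('a \<Rightarrow> real) \<Rightarrow> ('a \<Rightarrow> real) \<Rightarrow> ('a \<Rightarrow> real) \<Rightarrow> ereal" where
  "D_KL M \<eta>\<^sub>t \<eta>\<^sub>c \<alpha> = enn2ereal (CE M \<eta>\<^sub>t \<eta>\<^sub>c \<alpha>) - ereal (entropy_of M \<eta>\<^sub>c)"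

text \<open>Mappings into the positive reals, which is where the Bayes tilted estimate is defined.\<close>

definition alpha_mapping :: "'a measure \<Rightarrow> ('a \<Rightarrow> real) \<Rightarrow> bool" where
  "alpha_mapping M \<alpha> \<longleftrightarrow> \<alpha> \<in> borel_measurable M \<and> (\<forall>x\<in>space M. \<alpha> x > 0)"

definition optimal_mapping :: "'a measure \<Rightarrow> ('a \<Rightarrow> real) \<Rightarrow> ('a \<Rightarrow> real) \<Rightarrow> ('a \<Rightarrow> real) \<Rightarrow> bool" where
  "optimal_mapping M \<eta>\<^sub>t \<eta>\<^sub>c \<alpha> \<longleftrightarrow>
     alpha_mapping M \<alpha> \<and> (\<forall>\<beta>. alpha_mapping M \<beta> \<longrightarrow> D_KL M \<eta>\<^sub>t \<eta>\<^sub>c \<alpha> \<le> D_KL M \<eta>\<^sub>t \<eta>\<^sub>c \<beta>)"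

text \<open>Two pitfalls. At points with \<open>\<eta>\<^sub>t x = 1/2\<close> the tilted estimate is \<open>1/2\<close> for every \<open>\<alpha>\<close>, so
  \<open>D_KL\<close> does not depend on \<open>\<alpha>\<close> at all if this holds almost everywhere. At points with
  \<open>\<eta>\<^sub>c x \<in> {0, 1}\<close> and \<open>\<eta>\<^sub>t x \<noteq> 1/2\<close>, a strictly Bayes blunting twist has an integrand in \<open>CE\<close> that is
  strictly decreasing in \<open>\<alpha> x\<close>, so no real-valued mapping is optimal if such points have positive
  measure.\<close>

end

theory Submission
  imports Defs
begin

text \<open>In terms of the log-odds \<open>\<theta>\<close> of \<open>\<eta>\<^sub>t\<close> the pointwise cross-entropy is
  \<open>ln (1 + exp (\<alpha> \<theta>)) - \<eta>\<^sub>c \<alpha> \<theta>\<close>. By Gibbs' inequality its minimum over \<open>\<alpha>\<close> is the entropy of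
  \<open>\<eta>\<^sub>c\<close>, attained where \<open>\<alpha> \<theta>\<close> equals the log-odds of \<open>\<eta>\<^sub>c\<close>; blunting makes that ratio of log-odds
  exceed \<open>1\<close>. For the constant, \<open>\<theta>\<^sup>2 exp (- \<bar>\<theta>\<bar>) \<le> 2\<close> yields a second-order bound that is
  uniform in the point: replacing \<open>\<alpha> = 1\<close> by \<open>1 + h\<close> changes the cross-entropy by at most
  \<open>- h \<delta> + h\<^sup>2\<close> with \<open>\<delta> = \<integral> \<theta> (\<eta>\<^sub>c - \<eta>\<^sub>t) > 0\<close>, so \<open>h = \<delta> / 2\<close> gives a strict decrease.\<close>

section \<open>Log-odds and the logistic form of the tilted estimate\<close>

definition tilted_loss :: "real \<Rightarrow> real \<Rightarrow> real \<Rightarrow> real" where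
  "tilted_loss c v \<alpha> = - c * ln (tilted \<alpha> v) - (1 - c) * ln (tilted \<alpha> (1 - v))"

definition logit :: "real \<Rightarrow> real" where
  "logit v = ln v - ln (1 - v)"

lemma CE_eq_tilted_loss:
  "CE M \<eta>\<^sub>t \<eta>\<^sub>c \<alpha> = (\<integral>\<^sup>+ x. ennreal (tilted_loss (\<eta>\<^sub>c x) (\<eta>\<^sub>t x) (\<alpha> x)) \<partial>M)"
  by (simp add: CE_def tilted_loss_def)

lemma logit_compl: "logit (1 - v) = - logit v"
  by (simp add: logit_def)

text \<open>Swapping the two labels leaves the loss unchanged. This carries estimates for
  \<open>v\<close> below \<open>1 / 2\<close> over to \<open>v\<close> above
  \<open>1 / 2\<close>.\<close>

lemma tilted_loss_compl: "tilted_loss (1 - c) (1 - v) \<alpha> = tilted_loss c v \<alpha>"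
  by (simp add: tilted_loss_def algebra_simps)

lemma logit_eq_0_iff: "0 < v \<Longrightarrow> v < 1 \<Longrightarrow> logit v = 0 \<longleftrightarrow> v = 1 / 2"
  by (auto simp: logit_def)

lemma logit_less_iff:
  assumes "0 < u" "u < 1" "0 < v" "v < 1"
  shows "logit u < logit v \<longleftrightarrow> u < v"
proof -
  have "logit a < logit b" if "a < b" "0 < a" "b < 1" for a b
  proof -
    have "ln a < ln b" "ln (1 - b) < ln (1 - a)"
      using that by simp_all
    then show ?thesis by (simp add: logit_def)
  qed
  then show ?thesis
    using assms by (metis less_asym linorder_neqE_linordered_idom)
qed

lemma tilted_eq_logistic:
  assumes "0 < v" "v < 1"
  shows "tilted \<alpha> v = 1 / (1 + exp (- (\<alpha> * logit v)))"
proof -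
  have "(1 - v) powr \<alpha> = v powr \<alpha> * exp (- (\<alpha> * logit v))"
    using assms by (simp add: powr_def logit_def flip: exp_add) (simp add: algebra_simps)
  then have "v powr \<alpha> + (1 - v) powr \<alpha> = v powr \<alpha> * (1 + exp (- (\<alpha> * logit v)))"
    by (simp add: algebra_simps)
  then show ?thesis
    using assms by (simp add: tilted_def)
qed

lemma tilted_eq_exp:
  assumes "0 < v" "v < 1"
  shows "tilted \<alpha> v = exp (\<alpha> * logit v) / (1 + exp (\<alpha> * logit v))"
  using assms by (simp add: tilted_eq_logistic exp_minus field_simps)

lemma tilted_one: "0 < v \<Longrightarrow> v < 1 \<Longrightarrow> tilted 1 v = v"
  by (simp add: tilted_def)

lemma tilted_compl:
  assumes "0 < v" "v < 1"
  shows "tilted \<alpha> (1 - v) = 1 - tilted \<alpha> v"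
proof -
  have "v powr \<alpha> + (1 - v) powr \<alpha> > 0"
    using assms by (simp add: add_pos_pos)
  then show ?thesis
    by (simp add: tilted_def field_simps)
qed

lemma tilted_bounds:
  assumes "0 < v" "v < 1"
  shows "0 < tilted \<alpha> v" "tilted \<alpha> v < 1"
  using assms by (simp_all add: tilted_eq_logistic add_pos_pos)

text \<open>Tilting multiplies the log-odds by \<alpha>, so this \<alpha> moves the log-odds of
  \<open>v\<close> exactly onto those of \<open>c\<close>; \<open>v \<noteq> 1 / 2\<close> keeps the
  denominator nonzero.\<close>

lemma tilted_logit_ratio:
  assumes "0 < c" "c < 1" "0 < v" "v < 1" "v \<noteq> 1 / 2"
  shows "tilted (logit c / logit v) v = c"
proof -
  have "logit v \<noteq> 0"
    using assms logit_eq_0_iff by blast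
  then have "logit c / logit v * logit v = 1 * logit c"
    by simp
  then have "tilted (logit c / logit v) v = tilted 1 c"
    using assms by (metis tilted_eq_logistic)
  then show ?thesis
    using assms by (simp add: tilted_one)
qed

text \<open>The loss is the negative log-likelihood of a Bernoulli exponential family with natural
  parameter \<open>\<alpha> * logit v\<close>, averaged over a label of mean
  \<open>c\<close>.\<close>

lemma tilted_loss_eq_log_partition:
  assumes "0 < v" "v < 1"
  shows "tilted_loss c v \<alpha> = ln (1 + exp (\<alpha> * logit v)) - c * \<alpha> * logit v"
proof -
  let ?e = "exp (\<alpha> * logit v)"
  have pos: "1 + ?e > 0"
    by (simp add: add_pos_pos)
  have "ln (tilted \<alpha> v) = \<alpha> * logit v - ln (1 + ?e)"
    using assms pos by (simp add: tilted_eq_exp ln_div)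
  moreover have "ln (tilted \<alpha> (1 - v)) = - ln (1 + ?e)"
    using assms pos by (simp add: tilted_eq_logistic logit_compl ln_div)
  ultimately show ?thesis
    unfolding tilted_loss_def by (simp only:) (simp add: algebra_simps)
qed

lemma tilted_loss_nonneg:
  assumes "0 < v" "v < 1" "0 \<le> c" "c \<le> 1"
  shows "0 \<le> tilted_loss c v \<alpha>"
proof -
  have "ln (tilted \<alpha> v) \<le> 0" "ln (tilted \<alpha> (1 - v)) \<le> 0"
    using tilted_bounds[of v \<alpha>] tilted_bounds[of "1 - v" \<alpha>] assms by simp_all
  then have "c * ln (tilted \<alpha> v) \<le> 0" "(1 - c) * ln (tilted \<alpha> (1 - v)) \<le> 0"
    using assms by (simp_all add: mult_nonneg_nonpos)
  then show ?thesis
    by (simp add: tilted_loss_def)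
qed

section \<open>Gibbs' inequality and the pointwise optimum\<close>

lemma binary_entropy_le_cross_entropy:
  assumes "0 < c" "c < 1" "0 < p" "p < 1"
  shows "binary_entropy c \<le> - c * ln p - (1 - c) * ln (1 - p)"
proof -
  have gibbs: "a * (ln q - ln a) \<le> q - a" if "0 < a" "0 < q" for a q :: real
  proof -
    have "ln (q / a) \<le> q / a - 1"
      using that by (intro ln_le_minus_one) simp
    then have "a * ln (q / a) \<le> a * (q / a - 1)"
      using that by (intro mult_left_mono) auto
    then show ?thesis
      using that by (simp add: ln_div algebra_simps)
  qed
  show ?thesis
    using gibbs[of c p] gibbs[of "1 - c" "1 - p"] assms
    by (simp add: binary_entropy_def algebra_simps)
qed

lemma tilted_loss_logit_ratio_le:
  assumes "0 < c" "c < 1" "0 < v" "v < 1" "v \<noteq> 1 / 2"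
  shows "tilted_loss c v (logit c / logit v) \<le> tilted_loss c v \<beta>"
proof -
  have "tilted_loss c v (logit c / logit v) = binary_entropy c"
    using assms by (simp add: tilted_loss_def tilted_compl tilted_logit_ratio binary_entropy_def)
  also have "\<dots> \<le> tilted_loss c v \<beta>"
    using binary_entropy_le_cross_entropy[of c "tilted \<beta> v"] tilted_bounds[of v \<beta>] assms
    by (simp add: tilted_loss_def tilted_compl)
  finally show ?thesis .
qed

text \<open>\<open>logit\<close> increases and vanishes at \<open>1 / 2\<close>, and
  \<open>c\<close> lies on the same side of \<open>1 / 2\<close> as \<open>v\<close> but farther
  out. So both log-odds have the same sign and that of \<open>c\<close> is larger in
  modulus.\<close>

lemma blunting_logit_ratio_gt_1:
  assumes "0 < c" "c < 1" "0 < v" "v < 1" "v \<noteq> 1 / 2"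
    and "(c < v \<and> v \<le> 1 / 2) \<or> (c > v \<and> v \<ge> 1 / 2)"
  shows "logit c / logit v > 1"
proof -
  have half: "logit (1 / 2) = 0"
    by (simp add: logit_def)
  from assms(6) show ?thesis
  proof
    assume "c < v \<and> v \<le> 1 / 2"
    then have "logit c < logit v" "logit v < 0"
      using assms logit_less_iff[of c v] logit_less_iff[of v "1 / 2"] half by auto
    then show ?thesis
      by (simp add: field_simps)
  next
    assume "c > v \<and> v \<ge> 1 / 2"
    then have "logit v < logit c" "0 < logit v"
      using assms logit_less_iff[of v c] logit_less_iff[of "1 / 2" v] half by auto
    then show ?thesis
      by (simp add: field_simps)
  qed
qed

section \<open>Uniform second-order bound near \<alpha> = 1\<close>

lemma exp_le_quadratic_nonpos:
  fixes t :: real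
  assumes "t \<le> 0"
  shows "exp t \<le> 1 + t + t\<^sup>2 / 2"
proof -
  have pos: "1 + t + t\<^sup>2 / 2 > 0"
    using zero_le_power2[of "t + 1"] by (simp add: power2_eq_square algebra_simps)
  \<comment> \<open>The quadratics at \<open>t\<close> and \<open>- t\<close> multiply to
    \<open>1 + t ^ 4 / 4\<close>, and the one at \<open>- t\<close> is at most
    \<open>exp (- t)\<close> because \<open>- t \<ge> 0\<close>.\<close>
  have "1 \<le> 1 + t ^ 4 / 4"
    by simp
  also have "\<dots> = (1 + t + t\<^sup>2 / 2) * (1 + - t + (- t)\<^sup>2 / 2)"
    by (simp add: field_simps power2_eq_square power4_eq_xxxx)
  also have "\<dots> \<le> (1 + t + t\<^sup>2 / 2) * exp (- t)"
    using assms pos exp_lower_Taylor_quadratic[of "- t"] by (intro mult_left_mono) auto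
  finally show ?thesis
    by (simp add: exp_minus field_simps)
qed

context
  fixes c v :: real
  assumes c_nonneg: "0 \<le> c" and c_less: "c < v" and v_le: "v \<le> 1 / 2"
begin

lemma v_bounds: "0 < v" "v < 1"
  using c_nonneg c_less v_le by simp_all

lemma logit_nonpos_low: "logit v \<le> 0"
  using v_bounds v_le by (simp add: logit_def)

lemma v_le_exp_logit: "v \<le> exp (logit v)"
  using v_bounds by (simp add: logit_def exp_diff field_simps)

text \<open>The log-odds are unbounded as \<open>v\<close> tends to 0, but \<open>v\<close> is at
  most the odds \<open>exp (logit v)\<close>, and \<open>s * exp (- s) \<le> 1\<close> for
  \<open>s = - logit v\<close>.\<close>

lemma minus_logit_times_v_le: "- logit v * v \<le> 1"
proof -
  have "- logit v * v \<le> - logit v * exp (logit v)"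
    using v_le_exp_logit logit_nonpos_low by (intro mult_left_mono) auto
  also have "\<dots> \<le> 1"
  proof -
    have "- logit v \<le> exp (- logit v)"
      using exp_ge_add_one_self[of "- logit v"] by linarith
    then show ?thesis
      by (simp add: exp_minus field_simps)
  qed
  finally show ?thesis .
qed

lemma logit_square_times_v_le: "(logit v)\<^sup>2 * v \<le> 2"
proof -
  have "(logit v)\<^sup>2 * v \<le> (logit v)\<^sup>2 * exp (logit v)"
    using v_le_exp_logit by (intro mult_left_mono) auto
  also have "\<dots> \<le> 2"
  proof -
    have "(logit v)\<^sup>2 \<le> 2 * exp (- logit v)"
      using exp_lower_Taylor_quadratic[of "- logit v"] logit_nonpos_low by simp
    then show ?thesis
      by (simp add: exp_minus field_simps)
  qed
  finally show ?thesis .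
qed

text \<open>The slope \<open>logit v * (c - v)\<close> is minus the derivative of the loss in
  \<alpha> at 1. Its bounds later give integrability and a nonnegative mean.\<close>

lemma slope_bounds_low: "0 \<le> logit v * (c - v)" "logit v * (c - v) \<le> 1"
proof -
  show "0 \<le> logit v * (c - v)"
    using logit_nonpos_low c_less by (intro mult_nonpos_nonpos) auto
  have "logit v * c \<le> 0"
    using logit_nonpos_low c_nonneg by (intro mult_nonpos_nonneg) auto
  then show "logit v * (c - v) \<le> 1"
    using minus_logit_times_v_le by (simp add: algebra_simps)
qed

lemma tilted_loss_one_le_low: "tilted_loss c v 1 \<le> 2"
proof -
  have "ln (1 + exp (logit v)) \<le> exp (logit v)"
    by (intro ln_add_one_self_le_self) simp
  also have "exp (logit v) \<le> 1"
    using logit_nonpos_low by simp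
  finally have "ln (1 + exp (logit v)) \<le> 1" .
  moreover have "- logit v * c \<le> - logit v * v"
    using logit_nonpos_low c_less by (intro mult_left_mono) auto
  ultimately show ?thesis
    using minus_logit_times_v_le v_bounds
    by (simp add: tilted_loss_eq_log_partition algebra_simps)
qed

text \<open>The increment of the log-partition term is the cumulant generating function of a
  Bernoulli variable of mean \<open>v\<close>, taken at \<open>h * logit v \<le> 0\<close>. Bounding
  \<open>ln\<close> and \<open>exp\<close> leaves the remainder
  \<open>h\<^sup>2 * (logit v)\<^sup>2 * v / 2\<close>, which is at most
  \<open>h\<^sup>2\<close>.\<close>

lemma tilted_loss_one_plus_le_low:
  assumes "0 \<le> h"
  shows "tilted_loss c v (1 + h) \<le> tilted_loss c v 1 - h * (logit v * (c - v)) + h\<^sup>2"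
proof -
  let ?\<theta> = "logit v"
  let ?t = "h * ?\<theta>"
  have v: "v = exp ?\<theta> / (1 + exp ?\<theta>)"
    using tilted_eq_exp[of v 1] tilted_one[of v] v_bounds by simp
  have pos: "1 + exp ?\<theta> > 0"
    by (simp add: add_pos_pos)
  have e: "exp ?\<theta> = v * (1 + exp ?\<theta>)"
    using arg_cong[OF v, of "\<lambda>a. a * (1 + exp ?\<theta>)"] pos by simp
  have "1 + exp ((1 + h) * ?\<theta>) = (1 + exp ?\<theta>) + exp ?\<theta> * (exp ?t - 1)"
    by (simp add: distrib_right exp_add algebra_simps)
  also have "exp ?\<theta> * (exp ?t - 1) = v * (1 + exp ?\<theta>) * (exp ?t - 1)"
    using e by (rule arg_cong)
  finally have factor: "1 + exp ((1 + h) * ?\<theta>) = (1 + exp ?\<theta>) * (1 + v * (exp ?t - 1))"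
    by (simp add: algebra_simps)
  have pos': "1 + v * (exp ?t - 1) > 0"
  proof -
    have "(1 - v) + v * exp ?t > 0"
      using v_bounds by (intro add_pos_pos mult_pos_pos) auto
    then show ?thesis
      by (simp add: algebra_simps)
  qed
  have "ln (1 + exp ((1 + h) * ?\<theta>)) = ln (1 + exp ?\<theta>) + ln (1 + v * (exp ?t - 1))"
    unfolding factor using pos pos' by (simp add: ln_mult)
  also have "ln (1 + v * (exp ?t - 1)) \<le> v * (exp ?t - 1)"
    using ln_le_minus_one[OF pos'] by simp
  also have "v * (exp ?t - 1) \<le> v * (?t + ?t\<^sup>2 / 2)"
    using exp_le_quadratic_nonpos[of ?t] v_bounds logit_nonpos_low assms
    by (intro mult_left_mono) (auto simp: mult_nonneg_nonpos)
  also have "\<dots> = h * ?\<theta> * v + h\<^sup>2 * (?\<theta>\<^sup>2 * v) / 2"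
    by (simp add: algebra_simps power2_eq_square)
  also have "h\<^sup>2 * (?\<theta>\<^sup>2 * v) \<le> h\<^sup>2 * 2"
    using logit_square_times_v_le by (intro mult_left_mono) auto
  finally show ?thesis
    using v_bounds by (simp add: tilted_loss_eq_log_partition algebra_simps)
qed

end

text \<open>The case \<open>v \<ge> 1 / 2\<close> reduces to the other by swapping labels: replacing
  \<open>c\<close>, \<open>v\<close> by \<open>1 - c\<close>, \<open>1 - v\<close> preserves both
  slope and loss.\<close>

lemma blunting_estimates:
  assumes "0 \<le> c" "c \<le> 1" and "(c < v \<and> v \<le> 1 / 2) \<or> (c > v \<and> v \<ge> 1 / 2)"
  shows "0 \<le> logit v * (c - v)" (is ?A)
    and "logit v * (c - v) \<le> 1" (is ?B)
    and "tilted_loss c v 1 \<le> 2" (is ?C)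
    and "0 \<le> h \<Longrightarrow> tilted_loss c v (1 + h)
           \<le> tilted_loss c v 1 - h * (logit v * (c - v)) + h\<^sup>2" (is "_ \<Longrightarrow> ?D")
proof -
  have "?A \<and> ?B \<and> ?C \<and> (0 \<le> h \<longrightarrow> ?D)"
    using assms(3)
  proof
    assume "c < v \<and> v \<le> 1 / 2"
    then show ?thesis
      using assms slope_bounds_low tilted_loss_one_le_low tilted_loss_one_plus_le_low by blast
  next
    assume *: "c > v \<and> v \<ge> 1 / 2"
    have slope: "logit (1 - v) * ((1 - c) - (1 - v)) = logit v * (c - v)"
      by (simp add: logit_compl algebra_simps)
    have "0 \<le> 1 - c" "1 - c < 1 - v" "1 - v \<le> 1 / 2"
      using * assms by auto
    note low = slope_bounds_low[OF this] tilted_loss_one_le_low[OF this]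
      tilted_loss_one_plus_le_low[OF this]
    show ?thesis
      using low unfolding slope tilted_loss_compl by blast
  qed
  then show ?A ?B ?C "0 \<le> h \<Longrightarrow> ?D"
    by blast+
qed

section \<open>From cross-entropy to divergence, and the ordering\<close>

lemma D_KL_mono:
  "CE M \<eta>\<^sub>t \<eta>\<^sub>c \<alpha> \<le> CE M \<eta>\<^sub>t \<eta>\<^sub>c \<beta> \<Longrightarrow> D_KL M \<eta>\<^sub>t \<eta>\<^sub>c \<alpha> \<le> D_KL M \<eta>\<^sub>t \<eta>\<^sub>c \<beta>"
  unfolding D_KL_def by (intro ereal_minus_mono) (auto simp: less_eq_ennreal.rep_eq)

text \<open>The subtracted entropy is a real number, so strictness survives even if the larger
  cross-entropy is infinite.\<close>

lemma D_KL_less: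
  assumes "CE M \<eta>\<^sub>t \<eta>\<^sub>c \<alpha> < CE M \<eta>\<^sub>t \<eta>\<^sub>c \<beta>"
  shows "D_KL M \<eta>\<^sub>t \<eta>\<^sub>c \<alpha> < D_KL M \<eta>\<^sub>t \<eta>\<^sub>c \<beta>"
proof -
  have "enn2ereal (CE M \<eta>\<^sub>t \<eta>\<^sub>c \<alpha>) < enn2ereal (CE M \<eta>\<^sub>t \<eta>\<^sub>c \<beta>)"
    using assms by (simp add: less_ennreal.rep_eq)
  then show ?thesis
    unfolding D_KL_def
    by (cases "enn2ereal (CE M \<eta>\<^sub>t \<eta>\<^sub>c \<alpha>)"; cases "enn2ereal (CE M \<eta>\<^sub>t \<eta>\<^sub>c \<beta>)") auto
qed

theorem theorem9:
  fixes M :: "'a measure" and \<eta>\<^sub>c \<eta>\<^sub>t :: "'a \<Rightarrow> real"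
  assumes "prob_space M"
    and "posterior M \<eta>\<^sub>c"
    and "posterior M \<eta>\<^sub>t"
    and "strictly_Bayes_blunting M \<eta>\<^sub>c \<eta>\<^sub>t"
    and nondegenerate: "\<not> (AE x in M. \<eta>\<^sub>t x = 1/2)"
    and attained: "AE x in M. \<eta>\<^sub>c x \<in> {0, 1} \<longrightarrow> \<eta>\<^sub>t x = 1/2"
  shows "\<exists>\<alpha>\<^sub>0 > 1. \<exists>\<alpha>'. (\<forall>x\<in>space M. \<alpha>' x > 1) \<and> optimal_mapping M \<eta>\<^sub>t \<eta>\<^sub>c \<alpha>'
           \<and> D_KL M \<eta>\<^sub>t \<eta>\<^sub>c (\<lambda>_. 1) > D_KL M \<eta>\<^sub>t \<eta>\<^sub>c (\<lambda>_. \<alpha>\<^sub>0)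
           \<and> D_KL M \<eta>\<^sub>t \<eta>\<^sub>c (\<lambda>_. \<alpha>\<^sub>0) \<ge> D_KL M \<eta>\<^sub>t \<eta>\<^sub>c \<alpha>'"
proof -
  interpret prob_space M by fact
  have [measurable]: "\<eta>\<^sub>c \<in> borel_measurable M" "\<eta>\<^sub>t \<in> borel_measurable M"
    using assms by (auto simp: posterior_def)
  have c01: "0 \<le> \<eta>\<^sub>c x" "\<eta>\<^sub>c x \<le> 1" if "x \<in> space M" for x
    using assms that by (auto simp: posterior_def)
  have blunt: "(\<eta>\<^sub>c x < \<eta>\<^sub>t x \<and> \<eta>\<^sub>t x \<le> 1/2) \<or> (\<eta>\<^sub>c x > \<eta>\<^sub>t x \<and> \<eta>\<^sub>t x \<ge> 1/2)" if "x \<in> space M" for x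
    using assms that by (auto simp: strictly_Bayes_blunting_def)
  have v01: "0 < \<eta>\<^sub>t x" "\<eta>\<^sub>t x < 1" if "x \<in> space M" for x
    using c01[OF that] blunt[OF that] by auto
  note estimates = blunting_estimates[OF c01 blunt]

  \<comment> \<open>The value 2 only keeps the mapping above 1: at
    \<open>\<eta>\<^sub>t x = 1/2\<close> the loss is independent of \<alpha>, and by
    \<open>attained\<close> the other exceptional points form a null set.\<close>
  define ratio where
    "ratio x = (if \<eta>\<^sub>t x = 1/2 \<or> \<eta>\<^sub>c x = 0 \<or> \<eta>\<^sub>c x = 1 then 2 else logit (\<eta>\<^sub>c x) / logit (\<eta>\<^sub>t x))" for x
  have ratio_gt: "ratio x > 1" if "x \<in> space M" for x
    using c01[OF that] v01[OF that] blunt[OF that] blunting_logit_ratio_gt_1[of "\<eta>\<^sub>c x" "\<eta>\<^sub>t x"]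
    by (auto simp: ratio_def)
  have "CE M \<eta>\<^sub>t \<eta>\<^sub>c ratio \<le> CE M \<eta>\<^sub>t \<eta>\<^sub>c \<beta>" for \<beta>
    unfolding CE_eq_tilted_loss
  proof (intro nn_integral_mono_AE, use attained AE_space in eventually_elim)
    fix x assume triv: "\<eta>\<^sub>c x \<in> {0, 1} \<longrightarrow> \<eta>\<^sub>t x = 1/2" and x: "x \<in> space M"
    have "tilted_loss (\<eta>\<^sub>c x) (\<eta>\<^sub>t x) (ratio x) \<le> tilted_loss (\<eta>\<^sub>c x) (\<eta>\<^sub>t x) (\<beta> x)"
    proof (cases "\<eta>\<^sub>t x = 1/2")
      case True
      then have "logit (\<eta>\<^sub>t x) = 0"
        by (simp only: logit_def) simp
      then show ?thesis
        using v01[OF x] by (simp add: tilted_loss_eq_log_partition)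
    next
      case False
      then show ?thesis
        using tilted_loss_logit_ratio_le[of "\<eta>\<^sub>c x" "\<eta>\<^sub>t x"] triv c01[OF x] v01[OF x]
        by (auto simp: ratio_def)
    qed
    then show "ennreal (tilted_loss (\<eta>\<^sub>c x) (\<eta>\<^sub>t x) (ratio x)) \<le> ennreal (tilted_loss (\<eta>\<^sub>c x) (\<eta>\<^sub>t x) (\<beta> x))"
      by (rule ennreal_leI)
  qed
  then have ratio_le: "D_KL M \<eta>\<^sub>t \<eta>\<^sub>c ratio \<le> D_KL M \<eta>\<^sub>t \<eta>\<^sub>c \<beta>" for \<beta>
    by (rule D_KL_mono)
  have "ratio \<in> borel_measurable M"
    unfolding ratio_def[abs_def] logit_def by measurable
  then have optimal: "optimal_mapping M \<eta>\<^sub>t \<eta>\<^sub>c ratio"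
    using ratio_gt ratio_le by (force simp: optimal_mapping_def alpha_mapping_def)

  define slope where "slope x = logit (\<eta>\<^sub>t x) * (\<eta>\<^sub>c x - \<eta>\<^sub>t x)" for x
  have slope_meas [measurable]: "slope \<in> borel_measurable M"
    unfolding slope_def[abs_def] logit_def by measurable
  have int_slope: "integrable M slope"
    by (rule integrable_const_bound[of _ 1]) (use estimates in \<open>auto simp: slope_def\<close>)
  have slope_nonneg: "AE x in M. 0 \<le> slope x"
    using estimates(1) by (auto simp: slope_def)
  define \<delta> where "\<delta> = (\<integral>x. slope x \<partial>M)"
  \<comment> \<open>Blunting forces \<open>\<eta>\<^sub>c x \<noteq> \<eta>\<^sub>t x\<close>, so
    the slope vanishes only where \<open>logit (\<eta>\<^sub>t x) = 0\<close>, that is at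
    \<open>\<eta>\<^sub>t x = 1/2\<close>.\<close>
  have "\<delta> \<noteq> 0"
  proof
    assume "\<delta> = 0"
    then have "AE x in M. slope x = 0"
      using integral_nonneg_eq_0_iff_AE[OF int_slope slope_nonneg] by (simp add: \<delta>_def)
    with AE_space have "AE x in M. \<eta>\<^sub>t x = 1/2"
    proof eventually_elim
      fix x assume "x \<in> space M" "slope x = 0"
      then show "\<eta>\<^sub>t x = 1/2"
        using blunt[of x] v01[of x] logit_eq_0_iff[of "\<eta>\<^sub>t x"] by (auto simp: slope_def)
    qed
    then show False
      using nondegenerate by blast
  qed
  moreover have "\<delta> \<ge> 0"
    unfolding \<delta>_def using slope_nonneg by (rule integral_nonneg_AE)
  ultimately have \<delta>: "\<delta> > 0"
    by simp

  \<comment> \<open>This minimizes \<open>- h * \<delta> + h\<^sup>2\<close>; the guaranteed gain is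
    \<open>\<delta>\<^sup>2 / 4\<close>.\<close>
  define h where "h = \<delta> / 2"
  have h: "h > 0"
    using \<delta> by (simp add: h_def)
  define L where "L \<alpha> x = tilted_loss (\<eta>\<^sub>c x) (\<eta>\<^sub>t x) \<alpha>" for \<alpha> x
  have L_meas [measurable]: "L \<alpha> \<in> borel_measurable M" for \<alpha>
    unfolding L_def[abs_def] tilted_loss_def tilted_def by measurable
  have L_nonneg: "0 \<le> L \<alpha> x" if "x \<in> space M" for \<alpha> x
    unfolding L_def using c01 v01 that by (intro tilted_loss_nonneg) auto
  have L_step: "L (1 + h) x \<le> L 1 x - h * slope x + h\<^sup>2" if "x \<in> space M" for x
    using estimates(4)[OF that that that] h by (simp add: L_def slope_def)
  have int1: "integrable M (L 1)"
    by (rule integrable_const_bound[of _ 2])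
      (use estimates(3) L_nonneg[of _ 1] in \<open>auto simp: L_def\<close>)
  have int_bound: "integrable M (\<lambda>x. L 1 x - h * slope x + h\<^sup>2)"
    using int1 int_slope by auto
  \<comment> \<open>Since the loss is nonnegative, the one-sided bound \<open>L_step\<close> already
    dominates it in absolute value.\<close>
  have int_h: "integrable M (L (1 + h))"
    by (rule Bochner_Integration.integrable_bound[OF int_bound])
      (use L_step L_nonneg[of _ "1 + h"] in force)+
  have "(\<integral>x. L (1 + h) x \<partial>M) \<le> (\<integral>x. L 1 x - h * slope x + h\<^sup>2 \<partial>M)"
    using int_h int_bound L_step by (intro integral_mono) auto
  also have "\<dots> = (\<integral>x. L 1 x \<partial>M) - h * \<delta> + h\<^sup>2"
    using int1 int_slope by (simp add: \<delta>_def prob_space)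
  also have "\<dots> < (\<integral>x. L 1 x \<partial>M)"
    using \<delta> by (simp add: h_def power2_eq_square)
  finally have "(\<integral>x. L (1 + h) x \<partial>M) < (\<integral>x. L 1 x \<partial>M)" .
  \<comment> \<open>\<open>ennreal\<close> sends all negative reals to 0, so nonnegativity of the
    smaller integral is what carries the strict inequality over.\<close>
  moreover have "0 \<le> (\<integral>x. L (1 + h) x \<partial>M)"
    using L_nonneg by (intro integral_nonneg_AE) auto
  moreover have "CE M \<eta>\<^sub>t \<eta>\<^sub>c (\<lambda>_. \<alpha>) = ennreal (\<integral>x. L \<alpha> x \<partial>M)" if "integrable M (L \<alpha>)" for \<alpha>
    unfolding CE_eq_tilted_loss L_def[symmetric]
    using that L_nonneg by (intro nn_integral_eq_integral) auto
  ultimately have "CE M \<eta>\<^sub>t \<eta>\<^sub>c (\<lambda>_. 1 + h) < CE M \<eta>\<^sub>t \<eta>\<^sub>c (\<lambda>_. 1)"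
    using int1 int_h by (simp add: ennreal_less_iff)
  then have "D_KL M \<eta>\<^sub>t \<eta>\<^sub>c (\<lambda>_. 1 + h) < D_KL M \<eta>\<^sub>t \<eta>\<^sub>c (\<lambda>_. 1)"
    by (rule D_KL_less)
  then show ?thesis
    using h ratio_gt ratio_le optimal by (intro exI[of _ "1 + h"] conjI exI[of _ ratio]) auto
qed

end
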